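(* For every hypergraph $\mathcal{C}$, $\operatorname{conn}(\operatorname{Ind}(\mathcal{C}))\ge \epsilon(\mathcal{C})-2$.
   Context: A hypergraph $\mathcal{C}$ on a finite vertex set $V$ is a family of pairwise incomparable subsets of $V$ (its edges), each of cardinality at least $2$; a vertex lying in no edge is isolated. $\operatorname{Ind}(\mathcal{C})$ is the simplicial complex on $V$ whose faces are the subsets of $V$ containing no edge of $\mathcal{C}$. Two distinct vertices are neighbours if some edge contains both. A subfamily $\mathcal{F}\subseteq\mathcal{C}$ is edgewise dominant if every non-isolated vertex of $V$ either lies in some edge of $\mathcal{F}$ or has a neighbour lying in some edge of $\mathcal{F}$; $\epsilon(\mathcal{C})$ is the minimum cardinality of an edgewise dominant subfamily. The homotopical connectivity $\operatorname{conn}(\Delta)$ is the largest integer $k\ge -1$ such that $\Delta$ is nonempty and $\pi_i(\Delta)=0$ for all $0\le i\le k$; it is $\infty$ if all homotopy groups vanish, and $\operatorname{conn}(\{\emptyset\})=-2$. *)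

theory Defs
  imports "HOL-Analysis.Analysis"
begin

definition hypergraph :: "'a set \<Rightarrow> 'a set set \<Rightarrow> bool" where
  "hypergraph V C \<longleftrightarrow> finite V \<and> (\<forall>e\<in>C. e \<subseteq> V \<and> 2 \<le> card e)
     \<and> (\<forall>e\<in>C. \<forall>e'\<in>C. e \<subseteq> e' \<longrightarrow> e = e')"

definition Ind :: "'a set \<Rightarrow> 'a set set \<Rightarrow> 'a set set" where
  "Ind V C = {S. S \<subseteq> V \<and> (\<forall>e\<in>C. \<not> e \<subseteq> S)}"

definition isolated :: "'a set set \<Rightarrow> 'a \<Rightarrow> bool" where
  "isolated C v \<longleftrightarrow> (\<forall>e\<in>C. v \<notin> e)"

definition neighbours :: "'a set set \<Rightarrow> 'a \<Rightarrow> 'a \<Rightarrow> bool" where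
  "neighbours C u v \<longleftrightarrow> u \<noteq> v \<and> (\<exists>e\<in>C. u \<in> e \<and> v \<in> e)"

definition edgewise_dominant :: "'a set \<Rightarrow> 'a set set \<Rightarrow> 'a set set \<Rightarrow> bool" where
  "edgewise_dominant V C F \<longleftrightarrow> F \<subseteq> C \<and>
     (\<forall>v\<in>V. \<not> isolated C v \<longrightarrow>
        (\<exists>e\<in>F. v \<in> e) \<or> (\<exists>u. neighbours C v u \<and> (\<exists>e\<in>F. u \<in> e)))"

definition eps :: "'a set \<Rightarrow> 'a set set \<Rightarrow> nat" where
  "eps V C = Min {card F | F. edgewise_dominant V C F}"

definition realization :: "'a set set \<Rightarrow> ('a \<Rightarrow> real) set" where
  "realization \<Delta> = {f. (\<forall>x. 0 \<le> f x) \<and>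
     (\<exists>\<sigma>\<in>\<Delta>. finite \<sigma> \<and> {x. f x \<noteq> 0} \<subseteq> \<sigma> \<and> sum f \<sigma> = 1)}"

definition realization_top :: "'a set set \<Rightarrow> ('a \<Rightarrow> real) topology" where
  "realization_top \<Delta> = subtopology (powertop_real UNIV) (realization \<Delta>)"

text \<open>conn(\<Delta>) \<ge> k: for k \<le> -2 always (conn takes values \<ge> -2); otherwise |\<Delta>| is nonempty
  and for 0 \<le> i \<le> k every continuous map S^i \<rightarrow> |\<Delta>| is null-homotopic
  (equivalently \<pi>_i(|\<Delta>|) = 0 at every base point).\<close>
definition conn_ge :: "'a set set \<Rightarrow> int \<Rightarrow> bool" where
  "conn_ge \<Delta> k \<longleftrightarrow> k \<le> -2 \<or>
     (topspace (realization_top \<Delta>) \<noteq> {} \<and>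
      (\<forall>i::nat. int i \<le> k \<longrightarrow>
         (\<forall>f. continuous_map (nsphere i) (realization_top \<Delta>) f \<longrightarrow>
            (\<exists>c. homotopic_with (\<lambda>_. True) (nsphere i) (realization_top \<Delta>) f (\<lambda>_. c)))))"

end

theory Submission
  imports Defs
begin

text \<open>Connectivity is handled as an extension property: maps into the complex defined on a closed
  subset \<open>T\<close> of a Euclidean set extend whenever the complement of \<open>T\<close> has small dimension. Every map
  into a cone extends, and if two cones meet in a complex with the property in dimension \<open>d\<close>, their
  union has it in dimension \<open>d + 1\<close>: partition the domain along a set of dimension one less, extend
  first over the partition into the intersection, and then over the two sides into the cones. Hence
  joining a complex with the boundary of a simplex on \<open>e\<close> raises its connectivity by \<open>|e| - 1\<close>.

  The bound follows by induction on the number of edges. Deleting an edge \<open>e\<close> from \<open>C\<close> enlarges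
  \<open>Ind(C)\<close> by the join of \<open>e\<close> with the independence complex \<open>L\<close> of the contraction \<open>C / e\<close>, attached
  along the join of the boundary of \<open>e\<close> with \<open>L\<close>. Deletion does not decrease the domination number,
  and contraction decreases it by at most one, since \<open>e\<close> together with lifts of a dominating family
  of \<open>C / e\<close> dominates \<open>C\<close>.\<close>

section \<open>Extension over complements of bounded dimension\<close>

text \<open>The points of \<open>\<real>\<^sup>N\<close> with at least \<open>N - d\<close> coordinates in a countable set form a set of covering
  dimension at most \<open>d\<close>; this is the only instance of dimension theory needed, with \<open>d = m - 1\<close>.\<close>

definition thin :: "nat \<Rightarrow> nat \<Rightarrow> real set \<Rightarrow> (nat \<Rightarrow> real) set \<Rightarrow> bool" where
  "thin m N S Z \<longleftrightarrow> countable S \<and> (\<forall>x\<in>Z. N < card {i. i < N \<and> x i \<in> S} + m)"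

lemma thin_subset: "thin m N S Z \<Longrightarrow> W \<subseteq> Z \<Longrightarrow> thin m N S W"
  by (auto simp: thin_def)

text \<open>For a polyhedron \<open>Y\<close> this says that \<open>conn(Y) \<ge> m - 2\<close>.\<close>

definition extensor :: "nat \<Rightarrow> ('a \<Rightarrow> real) set \<Rightarrow> bool" where
  "extensor m Y \<longleftrightarrow> (\<forall>N S X T f.
     X \<subseteq> {x. \<forall>i\<ge>N. x i = 0} \<longrightarrow> closedin (top_of_set X) T \<longrightarrow> thin m N S (X - T) \<longrightarrow>
     continuous_on T f \<longrightarrow> f ` T \<subseteq> Y \<longrightarrow>
     (\<exists>g. continuous_on X g \<and> g ` X \<subseteq> Y \<and> (\<forall>x\<in>T. g x = f x)))"

lemma extensorD:
  assumes "extensor m Y" "X \<subseteq> {x. \<forall>i\<ge>N. x i = 0}" "closedin (top_of_set X) T"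
    "thin m N S (X - T)" "continuous_on T f" "f ` T \<subseteq> Y"
  obtains g where "continuous_on X g" "g ` X \<subseteq> Y" "\<And>x. x \<in> T \<Longrightarrow> g x = f x"
  using assms(1)[unfolded extensor_def, rule_format, OF assms(2-6)] by blast

text \<open>No point has more than \<open>N\<close> of its first \<open>N\<close> coordinates in
  \<open>S\<close>, so \<open>thin 0\<close> forces \<open>X = T\<close>.\<close>

lemma extensor_0: "extensor 0 Y"
  unfolding extensor_def
proof (intro allI impI)
  fix N S X T and f :: "(nat \<Rightarrow> real) \<Rightarrow> 'a \<Rightarrow> real"
  assume "closedin (top_of_set X) T" "thin 0 N S (X - T)" "continuous_on T f" "f ` T \<subseteq> Y"
  moreover have "card {i. i < N \<and> x i \<in> S} \<le> N" for x :: "nat \<Rightarrow> real"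
    using card_mono[of "{..<N}" "{i. i < N \<and> x i \<in> S}"] by auto
  ultimately have "T = X"
    unfolding thin_def by (force simp: not_less[symmetric] dest: closedin_imp_subset)
  then show "\<exists>g. continuous_on X g \<and> g ` X \<subseteq> Y \<and> (\<forall>x\<in>T. g x = f x)"
    using \<open>continuous_on T f\<close> \<open>f ` T \<subseteq> Y\<close> by blast
qed

lemma extensor_mono:
  assumes "extensor n Y" "m \<le> n"
  shows "extensor m Y"
proof -
  have thin: "thin n N S Z" if "thin m N S Z" for N S Z
    using that assms(2) unfolding thin_def by (meson add_left_mono order_less_le_trans)
  show ?thesis
    unfolding extensor_def
    using assms(1)[unfolded extensor_def, rule_format, OF _ _ thin] by simp
qed

text \<open>Extending the empty map over a one-point domain with \<open>N = 0\<close> produces a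
  point of \<open>Y\<close>.\<close>

lemma extensor_imp_nonempty:
  assumes "extensor (Suc m) Y"
  shows "Y \<noteq> {}"
proof -
  have "thin (Suc m) 0 {} ({\<lambda>_. 0} - {})"
    by (simp add: thin_def)
  then obtain g where "g ` {\<lambda>_::nat. 0::real} \<subseteq> Y"
    using extensorD[OF assms, of "{\<lambda>_. 0}" 0 "{}" "{}"] by (auto simp del: Diff_empty)
  then show ?thesis
    by auto
qed

section \<open>From extension of maps to connectivity\<close>

lemma closedin_sphere_cball:
  "closedin (top_of_set {x :: nat \<Rightarrow> real. (\<Sum>i\<le>n. (x i)\<^sup>2) \<le> 1 \<and> (\<forall>i>n. x i = 0)})
     {x. (\<Sum>i\<le>n. (x i)\<^sup>2) = 1 \<and> (\<forall>i>n. x i = 0)}" (is "closedin (top_of_set ?B) ?T")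
proof -
  have "continuous_on UNIV (\<lambda>x :: nat \<Rightarrow> real. \<Sum>i\<le>n. (x i)\<^sup>2)"
    by (intro continuous_intros continuous_on_subset[OF continuous_on_product_coordinates]) auto
  then have "closed ((\<lambda>x :: nat \<Rightarrow> real. \<Sum>i\<le>n. (x i)\<^sup>2) -` {1})"
    by (intro closed_vimage) auto
  moreover have "?T = ?B \<inter> (\<lambda>x. \<Sum>i\<le>n. (x i)\<^sup>2) -` {1}"
    by auto
  ultimately show ?thesis
    by (simp only: closedin_closed_Int)
qed

text \<open>A map of the sphere into an extensor extends over the ball, and the ball is contracted radially.\<close>

lemma extensor_imp_conn_ge:
  assumes "extensor m (realization \<Delta>)" and "k + 2 \<le> int m"
  shows "conn_ge \<Delta> k"
proof (cases "k \<le> -2")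
  case False
  then have "extensor (Suc (m - 1)) (realization \<Delta>)"
    using assms by simp
  then have ne: "topspace (realization_top \<Delta>) \<noteq> {}"
    unfolding realization_top_def using extensor_imp_nonempty by auto
  have top: "realization_top \<Delta> = top_of_set (realization \<Delta>)"
    unfolding realization_top_def by (simp add: euclidean_product_topology)
  have "\<exists>c. homotopic_with (\<lambda>_. True) (nsphere i) (realization_top \<Delta>) f (\<lambda>_. c)"
    if i: "int i \<le> k" and f: "continuous_map (nsphere i) (realization_top \<Delta>) f" for i f
  proof -
    define B :: "(nat \<Rightarrow> real) set" where "B = {x. (\<Sum>j\<le>i. (x j)\<^sup>2) \<le> 1 \<and> (\<forall>j>i. x j = 0)}"
    define T :: "(nat \<Rightarrow> real) set" where "T = {x. (\<Sum>j\<le>i. (x j)\<^sup>2) = 1 \<and> (\<forall>j>i. x j = 0)}"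
    have sph: "nsphere i = top_of_set T"
      by (simp add: nsphere euclidean_product_topology T_def)
    have B0: "B \<subseteq> {x. \<forall>j\<ge>Suc i. x j = 0}" and T: "closedin (top_of_set B) T"
      using closedin_sphere_cball[of i] by (auto simp: B_def T_def)
    \<comment> \<open>With \<open>S\<close> empty the count is zero, so thinness reads
      \<open>i + 1 < m\<close>, which follows from \<open>i \<le> k\<close> and
      \<open>k + 2 \<le> m\<close>.\<close>
    have thin: "thin m (Suc i) {} (B - T)"
      using i assms(2) by (auto simp: thin_def)
    have fT: "continuous_on T f" "f ` T \<subseteq> realization \<Delta>"
      using f unfolding sph top by auto
    obtain g where g: "continuous_on B g" "g ` B \<subseteq> realization \<Delta>"
      and gf: "\<And>x. x \<in> T \<Longrightarrow> g x = f x"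
      using extensorD[OF assms(1) B0 T thin fT] by blast
    define \<phi> where "\<phi> = (\<lambda>(t::real, x::nat \<Rightarrow> real) j. (1 - t) * x j)"
    have "continuous_on ({0..1} \<times> T) \<phi>"
      unfolding \<phi>_def case_prod_unfold
      by (intro continuous_on_coordinatewise_then_product continuous_on_mult continuous_on_diff
          continuous_on_const continuous_on_fst continuous_on_id
          continuous_on_product_then_coordinatewise[OF continuous_on_snd[OF continuous_on_id]])
    moreover have B: "\<phi> ` ({0..1} \<times> T) \<subseteq> B"
    proof clarify
      fix t :: real and x
      assume t: "t \<in> {0..1}" and x: "x \<in> T"
      have "(\<Sum>j\<le>i. (\<phi> (t, x) j)\<^sup>2) = (1 - t)\<^sup>2 * (\<Sum>j\<le>i. (x j)\<^sup>2)"
        by (simp add: \<phi>_def power_mult_distrib sum_distrib_left)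
      also have "\<dots> \<le> 1"
        using t x by (simp add: T_def power_le_one)
      finally show "\<phi> (t, x) \<in> B"
        using x by (simp add: B_def T_def \<phi>_def)
    qed
    ultimately have "continuous_on ({0..1} \<times> T) (g \<circ> \<phi>)"
      using continuous_on_compose[OF _ continuous_on_subset[OF g(1)]] by blast
    moreover have "(g \<circ> \<phi>) ` ({0..1} \<times> T) \<subseteq> realization \<Delta>"
      unfolding image_comp[symmetric] using image_mono[OF B, of g] g(2) by (rule subset_trans)
    moreover have "(g \<circ> \<phi>) (0, x) = f x" "(g \<circ> \<phi>) (1, x) = g (\<lambda>_. 0)" if "x \<in> T" for x
      using gf[OF that] by (simp_all add: \<phi>_def)
    ultimately have "homotopic_with (\<lambda>_. True) (top_of_set T) (top_of_set (realization \<Delta>)) f (\<lambda>_. g (\<lambda>_. 0))"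
      by (subst homotopic_with, simp)
        (rule exI[of _ "g \<circ> \<phi>"], simp add: image_subset_iff_funcset o_def)
    then show ?thesis
      unfolding sph top by blast
  qed
  then show ?thesis
    unfolding conn_ge_def using ne by blast
qed (simp add: conn_ge_def)

section \<open>Partitions of lower dimension\<close>

text \<open>Translate the rationals by a number outside the countable set of differences
  \<open>s - q\<close>.\<close>

lemma countable_dense_disjoint:
  fixes S :: "real set"
  assumes "countable S"
  obtains D where "countable D" "D \<inter> S = {}" "\<And>a b. a < b \<Longrightarrow> \<exists>d\<in>D. a < d \<and> d < b"
proof -
  have "countable ((\<lambda>(s, q). s - q) ` (S \<times> \<rat>))"
    using assms countable_rat by blast
  then obtain t where t: "t \<notin> (\<lambda>(s, q). s - q) ` (S \<times> \<rat>)"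
    using uncountable_UNIV_real by (metis UNIV_I countable_subset subsetI)
  show ?thesis
  proof
    show "countable ((+) t ` \<rat>)"
      using countable_rat by blast
    show "(+) t ` \<rat> \<inter> S = {}"
      using t by (force simp: image_iff)
    show "\<exists>d\<in>(+) t ` \<rat>. a < d \<and> d < b" if "a < b" for a b
      using Rats_dense_in_real[of "a - t" "b - t"] that by (auto simp: algebra_simps)
  qed
qed

text \<open>Boxes are indexed by pairs of corners, so that those with corners in a countable set can
  be enumerated.\<close>

definition open_box :: "nat \<Rightarrow> (nat \<Rightarrow> real) \<times> (nat \<Rightarrow> real) \<Rightarrow> (nat \<Rightarrow> real) set" where
  "open_box N p = {x. \<forall>i<N. fst p i < x i \<and> x i < snd p i}"

definition closed_box :: "nat \<Rightarrow> (nat \<Rightarrow> real) \<times> (nat \<Rightarrow> real) \<Rightarrow> (nat \<Rightarrow> real) set" where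
  "closed_box N p = {x. \<forall>i<N. fst p i \<le> x i \<and> x i \<le> snd p i}"

lemma open_box_subset: "open_box N p \<subseteq> closed_box N p"
  by (force simp: open_box_def closed_box_def)

lemma open_open_box: "open (open_box N p)"
proof -
  have "open_box N p = (\<Inter>i<N. {x. fst p i < x i} \<inter> {x. x i < snd p i})"
    by (auto simp: open_box_def)
  then show ?thesis
    by (auto intro!: open_INT open_Int open_Collect_less continuous_intros)
qed

lemma closed_closed_box: "closed (closed_box N p)"
proof -
  have "closed_box N p = (\<Inter>i<N. {x. fst p i \<le> x i} \<inter> {x. x i \<le> snd p i})"
    by (auto simp: closed_box_def)
  then show ?thesis
    by (auto intro!: closed_INT closed_Int closed_Collect_le continuous_intros)
qed

text \<open>A basic product neighbourhood is shrunk to intervals with endpoints in \<open>D\<close>.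
  Coordinates from \<open>N\<close> on vanish throughout \<open>X\<close>, so bounding the first
  \<open>N\<close> suffices.\<close>

lemma box_neighbourhood:
  assumes X: "X \<subseteq> {x. \<forall>i\<ge>N. x i = 0}" and "closedin (top_of_set X) P" "x \<in> X" "x \<notin> P"
    and dense: "\<And>a b :: real. a < b \<Longrightarrow> \<exists>d\<in>D. a < d \<and> d < b"
  obtains p where "p \<in> ({..<N} \<rightarrow>\<^sub>E D) \<times> ({..<N} \<rightarrow>\<^sub>E D)" "x \<in> open_box N p" "closed_box N p \<inter> P = {}"
proof -
  obtain Z where "closed Z" and P: "P = X \<inter> Z"
    using assms(2) closedin_closed by blast
  then have "openin (product_topology (\<lambda>_. euclidean) UNIV) (- Z)" "x \<in> - Z"
    using assms(3,4) by (auto simp: euclidean_product_topology)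
  from product_topology_open_contains_basis[OF this]
  obtain W where W: "\<And>i. x i \<in> W i" "\<And>i. open (W i)" "\<And>y. (\<And>i. y i \<in> W i) \<Longrightarrow> y \<notin> Z"
    by (auto simp: PiE_iff subset_iff)
  have "\<exists>l\<in>D. \<exists>u\<in>D. l < x i \<and> x i < u \<and> {l..u} \<subseteq> W i" for i
  proof -
    obtain e where e: "e > 0" "ball (x i) e \<subseteq> W i"
      using W(1,2) openE by blast
    obtain l u where "l \<in> D" "u \<in> D" "x i - e < l" "l < x i" "x i < u" "u < x i + e"
      using dense[of "x i - e" "x i"] dense[of "x i" "x i + e"] e by auto
    then show ?thesis
      using e by (fastforce simp: subset_iff dist_real_def)
  qed
  then obtain l u where lu: "\<And>i. l i \<in> D" "\<And>i. u i \<in> D" "\<And>i. l i < x i" "\<And>i. x i < u i" "\<And>i. {l i..u i} \<subseteq> W i"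
    by metis
  have "y \<notin> P" if y: "\<forall>i<N. l i \<le> y i \<and> y i \<le> u i" for y
  proof
    assume "y \<in> P"
    have "y i \<in> W i" for i
    proof (cases "i < N")
      case True
      then show ?thesis
        using y lu(5)[of i] by auto
    next
      case False
      then have "y i = 0" "x i = 0"
        using \<open>y \<in> P\<close> P X assms(3) by auto
      then show ?thesis
        using W(1)[of i] by simp
    qed
    then show False
      using W(3) P \<open>y \<in> P\<close> by blast
  qed
  then show thesis
    by (intro that[of "(restrict l {..<N}, restrict u {..<N})"])
      (auto simp: open_box_def closed_box_def lu)
qed

text \<open>A coordinate in \<open>D\<close> is not counted by \<open>S\<close>, so each point of
  \<open>L\<close> gains a counted coordinate, which pays for lowering \<open>Suc m\<close> to
  \<open>m\<close>.\<close>

lemma thin_refine: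
  assumes "thin (Suc m) N S Z" "countable D" "D \<inter> S = {}" "L \<subseteq> Z"
    and "\<And>x. x \<in> L \<Longrightarrow> \<exists>i<N. x i \<in> D"
  shows "thin m N (S \<union> D) L"
  unfolding thin_def
proof (intro conjI ballI)
  fix x assume "x \<in> L"
  then obtain j where j: "j < N" "x j \<in> D"
    using assms(5) by blast
  have "Suc (card {i. i < N \<and> x i \<in> S}) = card (insert j {i. i < N \<and> x i \<in> S})"
    using j assms(3) by (subst card_insert_disjoint) auto
  also have "\<dots> \<le> card {i. i < N \<and> x i \<in> S \<union> D}"
    using j by (intro card_mono) auto
  finally show "N < card {i. i < N \<and> x i \<in> S \<union> D} + m"
    using assms(1,4) \<open>x \<in> L\<close> unfolding thin_def by fastforce
qed (use assms in \<open>auto simp: thin_def\<close>)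

text \<open>The proof that regular second countable spaces are normal, run with boxes whose corners
  avoid \<^term>\<open>S\<close>: the partition lies in the union of the box boundaries, so each of its points has
  one more coordinate in a fixed countable set.\<close>

lemma thin_partition:
  assumes X: "X \<subseteq> {x. \<forall>i\<ge>N. x i = 0}"
    and P: "closedin (top_of_set X) P" and Q: "closedin (top_of_set X) Q"
    and thin: "thin (Suc m) N S (X - (P \<union> Q))"
  obtains P' Q' S' where "closedin (top_of_set X) P'" "closedin (top_of_set X) Q'" "P' \<union> Q' = X"
    "P' \<inter> (P \<union> Q) = P" "Q' \<inter> (P \<union> Q) = Q" "thin m N S' (P' \<inter> Q' - P \<inter> Q)"
proof -
  obtain D where D: "countable D" "D \<inter> S = {}" "\<And>a b. a < b \<Longrightarrow> \<exists>d\<in>D. a < d \<and> d < b"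
    using countable_dense_disjoint thin unfolding thin_def by metis
  define \<B> where "\<B> = ({..<N} \<rightarrow>\<^sub>E D) \<times> ({..<N} \<rightarrow>\<^sub>E D)"
  have "countable \<B>"
    using D(1) by (auto simp: \<B>_def intro!: countable_PiE)
  then obtain \<phi> :: "_ \<Rightarrow> nat" where inj: "inj_on \<phi> \<B>"
    by (auto simp: countable_def)
  \<comment> \<open>\<open>P\<close> and \<open>Q\<close> may intersect; what gets separated is
    \<open>P - Q\<close> from \<open>Q - P\<close>.\<close>
  define \<U> where "\<U> = {p \<in> \<B>. closed_box N p \<inter> (Q - P) = {}}"
  define \<V> where "\<V> = {p \<in> \<B>. closed_box N p \<inter> (P - Q) = {}}"
  have sub: "\<U> \<subseteq> \<B>" "\<V> \<subseteq> \<B>"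
    by (auto simp: \<U>_def \<V>_def)
  have fin: "finite {p \<in> \<A>. \<phi> p < n}" "finite {p \<in> \<A>. \<phi> p \<le> n}" if "\<A> \<subseteq> \<B>" for \<A> n
  proof -
    have "finite {p \<in> \<A>. \<phi> p \<le> n}"
      using that inj by (intro inj_on_finite[of \<phi> _ "{..n}"]) (auto simp: inj_on_def)
    then show "finite {p \<in> \<A>. \<phi> p < n}" "finite {p \<in> \<A>. \<phi> p \<le> n}"
      by (auto elim: rev_finite_subset)
  qed
  \<comment> \<open>The strict bound here and the weak one in \<open>V\<close> break ties: of two
    boxes, one from each family, exactly one has the other removed, so \<open>U\<close> and
    \<open>V\<close> are disjoint.\<close>
  define U where "U = (\<Union>p\<in>\<U>. open_box N p - (\<Union>q\<in>{q \<in> \<V>. \<phi> q < \<phi> p}. closed_box N q))"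
  define V where "V = (\<Union>q\<in>\<V>. open_box N q - (\<Union>p\<in>{p \<in> \<U>. \<phi> p \<le> \<phi> q}. closed_box N p))"
  have "open U" "open V"
    unfolding U_def V_def using fin sub
    by (auto intro!: open_UN open_Diff open_open_box closed_UN closed_closed_box)
  have "U \<inter> V = {}"
  proof (rule ccontr)
    assume "U \<inter> V \<noteq> {}"
    then obtain x where x: "x \<in> U" "x \<in> V"
      by blast
    obtain p where p: "p \<in> \<U>" "x \<in> open_box N p" "\<And>q. q \<in> \<V> \<Longrightarrow> \<phi> q < \<phi> p \<Longrightarrow> x \<notin> closed_box N q"
      using x(1) unfolding U_def by blast
    obtain q where q: "q \<in> \<V>" "x \<in> open_box N q" "\<And>p. p \<in> \<U> \<Longrightarrow> \<phi> p \<le> \<phi> q \<Longrightarrow> x \<notin> closed_box N p"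
      using x(2) unfolding V_def by blast
    show False
      using p q open_box_subset by (meson in_mono not_less)
  qed
  have PX: "P \<subseteq> X" and QX: "Q \<subseteq> X"
    using P Q closedin_imp_subset by auto
  have inU: "\<exists>p\<in>\<U>. x \<in> open_box N p" if x: "x \<in> X" "x \<notin> Q" for x
  proof -
    obtain p where "p \<in> \<B>" "x \<in> open_box N p" "closed_box N p \<inter> Q = {}"
      using box_neighbourhood[OF X Q x D(3)] unfolding \<B>_def .
    then show ?thesis
      by (intro bexI[of _ p]) (auto simp: \<U>_def)
  qed
  have inV: "\<exists>p\<in>\<V>. x \<in> open_box N p" if x: "x \<in> X" "x \<notin> P" for x
  proof -
    obtain p where "p \<in> \<B>" "x \<in> open_box N p" "closed_box N p \<inter> P = {}"
      using box_neighbourhood[OF X P x D(3)] unfolding \<B>_def .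
    then show ?thesis
      by (intro bexI[of _ p]) (auto simp: \<V>_def)
  qed
  have PU: "P - Q \<subseteq> U"
    using inU PX unfolding U_def \<V>_def by blast
  have QV: "Q - P \<subseteq> V"
    using inV QX unfolding V_def \<U>_def by blast
  have PV: "(P - Q) \<inter> V = {}" and QU: "(Q - P) \<inter> U = {}"
    using open_box_subset unfolding U_def V_def \<U>_def \<V>_def by blast+
  \<comment> \<open>If no coordinate of \<open>x\<close> is in \<open>D\<close>, the closed boxes
    containing \<open>x\<close> contain it in their interiors. The one of least index is not cut
    away at \<open>x\<close> and puts \<open>x\<close> into \<open>U\<close> or
    \<open>V\<close>.\<close>
  have boundary: "\<exists>i<N. x i \<in> D" if x: "x \<in> X" "x \<notin> P \<inter> Q" "x \<notin> U" "x \<notin> V" for x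
  proof (rule ccontr)
    assume nD: "\<not> (\<exists>i<N. x i \<in> D)"
    have eq: "x \<in> open_box N p" if "p \<in> \<B>" "x \<in> closed_box N p" for p
      unfolding open_box_def
    proof clarify
      fix i assume i: "i < N"
      then have "fst p i \<in> D" "snd p i \<in> D" "fst p i \<le> x i" "x i \<le> snd p i"
        using that by (auto simp: \<B>_def closed_box_def)
      then show "fst p i < x i \<and> x i < snd p i"
        using nD i by (metis order_le_less)
    qed
    define R where "R p \<longleftrightarrow> p \<in> \<U> \<union> \<V> \<and> x \<in> open_box N p" for p
    have "\<exists>p. R p"
      using inU inV x unfolding R_def by blast
    then obtain p where p: "R p" and min: "\<And>q. R q \<Longrightarrow> \<phi> p \<le> \<phi> q"
      using arg_min_nat_lemma[of R _ \<phi>] by metis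
    have first: "x \<notin> closed_box N q" if "q \<in> \<U> \<union> \<V>" "\<phi> q < \<phi> p" for q
      using that eq min sub unfolding R_def by (meson leD Un_iff in_mono)
    show False
    proof (cases "p \<in> \<U>")
      case True
      then have "x \<in> U"
        using p first unfolding U_def R_def by blast
      then show False
        using x by blast
    next
      case False
      \<comment> \<open>A box of \<open>\<U>\<close> with index equal to that of \<open>p\<close>
        would be \<open>p\<close> itself by injectivity.\<close>
      then have "x \<notin> closed_box N q" if "q \<in> \<U>" "\<phi> q \<le> \<phi> p" for q
        using that p first[of q] sub inj unfolding R_def
        by (metis UnCI UnE inj_onD order_le_less subsetD)
      moreover have "p \<in> \<V>"
        using p False unfolding R_def by blast
      ultimately have "x \<in> V"
        using p unfolding V_def R_def by blast
      then show False
        using x by blast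
    qed
  qed
  \<comment> \<open>Points of \<open>P \<inter> Q\<close> may lie in \<open>U\<close> or
    \<open>V\<close> and are put back on both sides.\<close>
  define P' where "P' = X - (V - P \<inter> Q)"
  define Q' where "Q' = X - (U - P \<inter> Q)"
  have PQ: "closedin (top_of_set X) (P \<inter> Q)"
    using P Q by blast
  have cl: "closedin (top_of_set X) (X - (G - P \<inter> Q))" if "open G" for G
  proof -
    have "X - (G - P \<inter> Q) = (X - G) \<union> (P \<inter> Q)"
      using PX by blast
    moreover have "closedin (top_of_set X) (X - G)"
      using that by (metis Diff_eq closed_Compl closedin_closed_Int)
    ultimately show ?thesis
      using PQ closedin_Un by metis
  qed
  show thesis
  proof
    show "closedin (top_of_set X) P'" "closedin (top_of_set X) Q'"
      unfolding P'_def Q'_def using cl \<open>open U\<close> \<open>open V\<close> by blast+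
    show "P' \<union> Q' = X"
      using \<open>U \<inter> V = {}\<close> unfolding P'_def Q'_def by blast
    show P'T: "P' \<inter> (P \<union> Q) = P"
      using PV QV PX unfolding P'_def by blast
    show Q'T: "Q' \<inter> (P \<union> Q) = Q"
      using QU PU QX unfolding Q'_def by blast
    show "thin m N (S \<union> D) (P' \<inter> Q' - P \<inter> Q)"
    proof (rule thin_refine[OF thin D(1,2)])
      show "P' \<inter> Q' - P \<inter> Q \<subseteq> X - (P \<union> Q)"
        using P'T Q'T \<open>P' \<union> Q' = X\<close> by blast
      show "\<exists>i<N. x i \<in> D" if "x \<in> P' \<inter> Q' - P \<inter> Q" for x
        using that boundary unfolding P'_def Q'_def by blast
    qed
  qed
qed

section \<open>Cones and unions of complexes\<close>

definition complex_on :: "'a set \<Rightarrow> 'a set set \<Rightarrow> bool" where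
  "complex_on V K \<longleftrightarrow> finite V \<and> K \<subseteq> Pow V \<and> (\<forall>S\<in>K. \<forall>R\<subseteq>S. R \<in> K)"

lemma complex_onD:
  assumes "complex_on V K"
  shows "finite V" "finite K" "\<And>S. S \<in> K \<Longrightarrow> finite S" "\<And>S. S \<in> K \<Longrightarrow> S \<subseteq> V"
    "\<And>R S. S \<in> K \<Longrightarrow> R \<subseteq> S \<Longrightarrow> R \<in> K"
  using assms unfolding complex_on_def by (auto intro: finite_subset)

text \<open>Faces are closed under subsets, so the support can replace the existential face;
  coordinates outside it add nothing to the sum over \<open>V\<close>.\<close>

lemma realization_iff:
  assumes "complex_on V K"
  shows "f \<in> realization K \<longleftrightarrow> (\<forall>v. 0 \<le> f v) \<and> {v. f v \<noteq> 0} \<in> K \<and> sum f V = 1"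
proof -
  note K = complex_onD[OF assms]
  have *: "sum f S = sum f V" if "S \<in> K" "{v. f v \<noteq> 0} \<subseteq> S" for S
    using K that by (intro sum.mono_neutral_left) auto
  show ?thesis
  proof
    assume "f \<in> realization K"
    then obtain S where "\<forall>v. 0 \<le> f v" "S \<in> K" "{v. f v \<noteq> 0} \<subseteq> S" "sum f S = 1"
      unfolding realization_def by auto
    then show "(\<forall>v. 0 \<le> f v) \<and> {v. f v \<noteq> 0} \<in> K \<and> sum f V = 1"
      using * K(5) by auto
  next
    assume f: "(\<forall>v. 0 \<le> f v) \<and> {v. f v \<noteq> 0} \<in> K \<and> sum f V = 1"
    then have "sum f {v. f v \<noteq> 0} = 1"
      using *[of "{v. f v \<noteq> 0}"] by simp
    then show "f \<in> realization K"
      unfolding realization_def using f K(3) by blast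
  qed
qed

lemma complex_on_Int:
  assumes "complex_on V K" "complex_on V L"
  shows "complex_on V (K \<inter> L)"
  unfolding complex_on_def
proof (intro conjI ballI allI impI)
  show "finite V" "K \<inter> L \<subseteq> Pow V"
    using assms by (auto simp: complex_on_def)
  show "R \<in> K \<inter> L" if "S \<in> K \<inter> L" "R \<subseteq> S" for R S
    using that complex_onD(5)[OF assms(1), of S R] complex_onD(5)[OF assms(2), of S R] by simp
qed

lemma realization_Int:
  assumes "complex_on V K" "complex_on V L"
  shows "realization (K \<inter> L) = realization K \<inter> realization L"
  by (auto simp: realization_iff[OF assms(1)] realization_iff[OF assms(2)]
      realization_iff[OF complex_on_Int[OF assms]])

lemma realization_Un: "realization (K \<union> L) = realization K \<union> realization L"
  unfolding realization_def by auto

lemma closed_realization: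
  assumes "complex_on V K"
  shows "closed (realization K)"
proof -
  note K = complex_onD[OF assms]
  have "realization K = (\<Union>S\<in>K. (\<Inter>v. {f. 0 \<le> f v}) \<inter> (\<Inter>v\<in>-S. {f. f v = 0}) \<inter> {f. sum f S = 1})"
    using K(3) unfolding realization_def by auto
  moreover have "closed ((\<Inter>v. {f :: 'a \<Rightarrow> real. 0 \<le> f v}) \<inter> (\<Inter>v\<in>-S. {f. f v = 0}) \<inter> {f. sum f S = 1})" for S
    by (intro closed_Int closed_INT ballI closed_Collect_le closed_Collect_eq continuous_on_const
        continuous_on_sum continuous_on_product_coordinates)
  ultimately show ?thesis
    using K(2) by (auto intro: closed_UN)
qed

lemma closedin_preimage_realization:
  assumes "complex_on V K" "continuous_on T f"
  shows "closedin (top_of_set T) {x \<in> T. f x \<in> realization K}"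
  using continuous_closedin_preimage[OF assms(2) closed_realization[OF assms(1)]]
  by (simp add: vimage_def Int_def)

section \<open>Extension of maps into a cone\<close>

lemma continuous_on_Min_image:
  fixes f :: "'v \<Rightarrow> 'b::topological_space \<Rightarrow> real"
  assumes "finite A" "A \<noteq> {}" "\<And>v. v \<in> A \<Longrightarrow> continuous_on X (f v)"
  shows "continuous_on X (\<lambda>x. Min ((\<lambda>v. f v x) ` A))"
  using assms by (induction rule: finite_ne_induct) (auto intro: continuous_on_min)

text \<open>The extension is explicit: extend the coordinates by Tietze; subtracting from all of them the
  amount \<open>m\<close>, which is at least the minimum over every non-face, makes the support of the coordinates
  off the apex \<open>a\<close> a face; \<open>m\<close> and the defect of the total are then added to the coordinate of \<open>a\<close>,
  so that normalising is possible.\<close>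

lemma cone_extension:
  fixes f :: "(nat \<Rightarrow> real) \<Rightarrow> 'a \<Rightarrow> real"
  assumes K: "complex_on V K" and "a \<in> V" "{} \<in> K" and cone: "\<And>S. S \<in> K \<Longrightarrow> insert a S \<in> K"
    and T: "closedin (top_of_set X) T" and f: "continuous_on T f" "f ` T \<subseteq> realization K"
  obtains g where "continuous_on X g" "g ` X \<subseteq> realization K" "\<And>x. x \<in> T \<Longrightarrow> g x = f x"
proof -
  note K' = complex_onD[OF K]
  have "\<exists>g. continuous_on X g \<and> (\<forall>x\<in>T. g x = f x v)" for v
  proof -
    have bound: "norm (f x v) \<le> 1" if "x \<in> T" for x
    proof (cases "v \<in> V")
      case True
      then show ?thesis
        using that f(2) K'(1) member_le_sum[of v V "f x"] by (fastforce simp: realization_iff[OF K])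
    next
      case False
      then have "f x v = 0"
        using that f(2) K'(4) by (fastforce simp: realization_iff[OF K])
      then show ?thesis
        by simp
    qed
    show ?thesis
      by (rule Tietze[OF continuous_on_product_then_coordinatewise[OF f(1), of v] T zero_le_one bound])
        auto
  qed
  then have "\<exists>h. \<forall>v. continuous_on X (h v) \<and> (\<forall>x\<in>T. h v x = f x v)"
    by (intro choice allI)
  then obtain h where h: "\<And>v. continuous_on X (h v)" "\<And>v x. x \<in> T \<Longrightarrow> h v x = f x v"
    by blast
  define y where "y v x = max 0 (h v x)" for v x
  define NF where "NF = {S. S \<subseteq> V - {a} \<and> S \<notin> K}"
  define m where "m x = (\<Sum>S\<in>NF. Min ((\<lambda>v. y v x) ` S))" for x
  define s where "s x = m x + \<bar>1 - (\<Sum>v\<in>V. y v x)\<bar>" for x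
  define r where "r v x = (if v = a then y a x + s x else if v \<in> V then max 0 (y v x - m x) else 0)" for v x
  define t where "t x = (\<Sum>v\<in>V. r v x)" for x
  have y: "continuous_on X (y v)" "y v x \<ge> 0" for v x
    unfolding y_def using h(1) by (auto intro: continuous_on_max)
  have NF: "finite NF" "\<And>S. S \<in> NF \<Longrightarrow> finite S \<and> S \<noteq> {}"
    using K'(1) \<open>{} \<in> K\<close> by (auto simp: NF_def intro: finite_subset)
  have "continuous_on X m"
    unfolding m_def using NF y(1) by (intro continuous_on_sum continuous_on_Min_image) auto
  then have s: "continuous_on X s"
    unfolding s_def using y(1) by (intro continuous_intros)
  have r: "continuous_on X (r v)" for v
    unfolding r_def using y(1) s \<open>continuous_on X m\<close> by (cases "v = a"; cases "v \<in> V") (auto intro!: continuous_intros)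
  have Min0: "Min ((\<lambda>v. y v x) ` S) \<ge> 0" if "S \<in> NF" for x S
    using NF(2)[OF that] y(2) by auto
  have m: "m x \<ge> 0" for x
    unfolding m_def using Min0 by (auto intro: sum_nonneg)
  then have r0: "r v x \<ge> 0" for v x
    unfolding r_def s_def using y(2) by auto
  \<comment> \<open>Either \<open>s x\<close> vanishes, and then \<open>y\<close> already sums to
    one and \<open>r\<close> agrees with it on \<open>V\<close>, or the coordinate at
    \<open>a\<close> is positive.\<close>
  have t_pos: "t x > 0" for x
  proof (cases "s x = 0")
    case True
    then have "m x = 0" "(\<Sum>v\<in>V. y v x) = 1"
      using m[of x] unfolding s_def by linarith+
    moreover have "r v x = y v x" if "v \<in> V" for v
      using that True \<open>m x = 0\<close> y(2)[of v x] by (simp add: r_def)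
    ultimately show ?thesis
      by (simp add: t_def)
  next
    case False
    then have "r a x > 0"
      using m[of x] y(2)[of a x] by (simp add: r_def s_def)
    then show ?thesis
      unfolding t_def using K'(1) \<open>a \<in> V\<close> r0 by (intro sum_pos2) auto
  qed
  have face: "{v. r v x \<noteq> 0} \<in> K" for x
  proof -
    \<comment> \<open>Were \<open>R\<close> a non-face, its minimum would be a summand of
      \<open>m x\<close>, yet all its coordinates exceed \<open>m x\<close>.\<close>
    define R where "R = {v \<in> V - {a}. m x < y v x}"
    have "R \<in> K"
    proof (rule ccontr)
      assume "R \<notin> K"
      then have "R \<in> NF"
        unfolding NF_def R_def by blast
      then have "Min ((\<lambda>v. y v x) ` R) \<le> m x"
        unfolding m_def using NF(1) Min0 by (intro member_le_sum) auto
      then show False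
        using NF(2)[OF \<open>R \<in> NF\<close>] unfolding R_def by (subst (asm) Min_le_iff) auto
    qed
    moreover have "{v. r v x \<noteq> 0} \<subseteq> insert a R"
      unfolding r_def R_def by auto
    ultimately show ?thesis
      using cone K'(5) by blast
  qed
  have rf: "r v x = f x v" if x: "x \<in> T" for v x
  proof -
    have fx: "\<And>v. 0 \<le> f x v" "{v. f x v \<noteq> 0} \<in> K" "sum (f x) V = 1"
      using f(2) x realization_iff[OF K] by blast+
    then have yf: "y v x = f x v" for v
      using h(2)[OF x] by (simp add: y_def)
    \<comment> \<open>A non-face contains a vertex outside the support of \<open>f x\<close>, so on
      \<open>T\<close> nothing is subtracted.\<close>
    have "Min ((\<lambda>v. y v x) ` S) = 0" if S: "S \<in> NF" for S
    proof -
      obtain v where "v \<in> S" "f x v = 0"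
        using S fx(2) K'(5) unfolding NF_def by blast
      then have "Min ((\<lambda>v. y v x) ` S) \<le> 0"
        using NF(2)[OF S] yf by (metis Min_le finite_imageI imageI)
      then show ?thesis
        using Min0[OF S, of x] by simp
    qed
    then have "m x = 0"
      by (simp add: m_def)
    moreover have "s x = 0"
      using \<open>m x = 0\<close> fx(3) yf by (simp add: s_def)
    moreover have "f x v = 0" if "v \<notin> V" for v
      using that fx(2) K'(4) by blast
    ultimately show ?thesis
      using fx(1) yf by (auto simp: r_def)
  qed
  define g where "g x v = r v x / t x" for x v
  have sumg: "sum (g x) V = 1" for x
    using t_pos[of x] by (simp add: g_def t_def sum_divide_distrib[symmetric])
  show thesis
  proof
    show "continuous_on X g"
      unfolding g_def t_def using r t_pos
      by (intro continuous_on_coordinatewise_then_product continuous_on_divide continuous_on_sum)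
        (auto simp: t_def less_imp_neq[symmetric])
    have "{v. g x v \<noteq> 0} = {v. r v x \<noteq> 0}" for x
      using t_pos[of x] by (auto simp: g_def)
    then show "g ` X \<subseteq> realization K"
      using face sumg r0 less_imp_le[OF t_pos] by (auto simp: realization_iff[OF K] g_def)
    show "g x = f x" if "x \<in> T" for x
    proof -
      have "t x = 1"
        using that rf f(2) by (fastforce simp: t_def realization_iff[OF K])
      then show ?thesis
        using rf[OF that] by (auto simp: g_def)
    qed
  qed
qed

lemma extensor_cone:
  assumes "complex_on V K" "a \<in> V" "{} \<in> K" "\<And>S. S \<in> K \<Longrightarrow> insert a S \<in> K"
  shows "extensor m (realization K)"
  unfolding extensor_def
proof (intro allI impI)
  fix N S X T and f :: "(nat \<Rightarrow> real) \<Rightarrow> 'a \<Rightarrow> real"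
  assume *: "closedin (top_of_set X) T" "continuous_on T f" "f ` T \<subseteq> realization K"
  show "\<exists>g. continuous_on X g \<and> g ` X \<subseteq> realization K \<and> (\<forall>x\<in>T. g x = f x)"
    by (rule cone_extension[OF assms *]) auto
qed

section \<open>Gluing maps over a union of two complexes\<close>

lemma continuous_on_glue:
  assumes "closedin (top_of_set (A \<union> B)) A" "closedin (top_of_set (A \<union> B)) B"
    and "continuous_on A f" "continuous_on B g" "\<And>x. x \<in> A \<Longrightarrow> x \<in> B \<Longrightarrow> f x = g x"
  shows "\<exists>h. continuous_on (A \<union> B) h \<and> (\<forall>x\<in>A. h x = f x) \<and> (\<forall>x\<in>B. h x = g x)"
proof (intro exI conjI)
  show "continuous_on (A \<union> B) (\<lambda>x. if x \<in> A then f x else g x)"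
    using assms by (intro continuous_on_cases_local) auto
qed (use assms(5) in auto)

text \<open>Serves to prescribe a map on the original closed set and on the partition at
  once.\<close>

lemma cone_extension_glue:
  fixes f g :: "(nat \<Rightarrow> real) \<Rightarrow> 'a \<Rightarrow> real"
  assumes K: "complex_on V K" "a \<in> V" "{} \<in> K" "\<And>S. S \<in> K \<Longrightarrow> insert a S \<in> K"
    and A: "closedin (top_of_set X) A" and B: "closedin (top_of_set X) B"
    and f: "continuous_on A f" "f ` A \<subseteq> realization K"
    and g: "continuous_on B g" "g ` B \<subseteq> realization K"
    and fg: "\<And>x. x \<in> A \<Longrightarrow> x \<in> B \<Longrightarrow> f x = g x"
  obtains h where "continuous_on X h" "h ` X \<subseteq> realization K" 
    "\<And>x. x \<in> A \<Longrightarrow> h x = f x" "\<And>x. x \<in> B \<Longrightarrow> h x = g x"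
proof -
  have sub: "A \<subseteq> X" "B \<subseteq> X"
    using A B closedin_imp_subset by auto
  have "closedin (top_of_set (A \<union> B)) A" "closedin (top_of_set (A \<union> B)) B"
    using A B sub closedin_subset_trans[of X _ "A \<union> B"] by auto
  then obtain k where k: "continuous_on (A \<union> B) k" "\<And>x. x \<in> A \<Longrightarrow> k x = f x" "\<And>x. x \<in> B \<Longrightarrow> k x = g x"
    using continuous_on_glue[OF _ _ f(1) g(1) fg] by blast
  have cl: "closedin (top_of_set X) (A \<union> B)"
    using A B closedin_Un by blast
  have im: "k ` (A \<union> B) \<subseteq> realization K"
    using f(2) g(2) k by auto
  obtain h where h: "continuous_on X h" "h ` X \<subseteq> realization K" "\<And>x. x \<in> A \<union> B \<Longrightarrow> h x = k x"
    using cone_extension[OF K cl k(1) im] by blast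
  then show thesis
    using k by (intro that[of h]) auto
qed

text \<open>Up to homotopy the union of two cones is the suspension of their intersection, which
  explains the gain of one.\<close>

lemma extensor_Un_cones:
  assumes K: "complex_on V K" "a \<in> V" "{} \<in> K" "\<And>S. S \<in> K \<Longrightarrow> insert a S \<in> K"
    and L: "complex_on V L" "b \<in> V" "{} \<in> L" "\<And>S. S \<in> L \<Longrightarrow> insert b S \<in> L"
    and KL: "extensor m (realization (K \<inter> L))"
  shows "extensor (Suc m) (realization (K \<union> L))"
  unfolding extensor_def
proof (intro allI impI)
  fix N S X T and f :: "(nat \<Rightarrow> real) \<Rightarrow> 'a \<Rightarrow> real"
  assume X: "X \<subseteq> {x. \<forall>i\<ge>N. x i = 0}" and T: "closedin (top_of_set X) T"
    and thin: "thin (Suc m) N S (X - T)" and f: "continuous_on T f" "f ` T \<subseteq> realization (K \<union> L)"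
  define P where "P = {x \<in> T. f x \<in> realization K}"
  define Q where "Q = {x \<in> T. f x \<in> realization L}"
  have TPQ: "T = P \<union> Q"
    using f(2) by (auto simp: P_def Q_def realization_Un)
  have P: "closedin (top_of_set X) P" and Q: "closedin (top_of_set X) Q"
    unfolding P_def Q_def
    using closedin_trans[OF closedin_preimage_realization[OF K(1) f(1)] T]
      closedin_trans[OF closedin_preimage_realization[OF L(1) f(1)] T] .
  obtain P' Q' S' where P': "closedin (top_of_set X) P'" and Q': "closedin (top_of_set X) Q'"
    and PQ': "P' \<union> Q' = X" "P' \<inter> (P \<union> Q) = P" "Q' \<inter> (P \<union> Q) = Q"
    and thin': "thin m N S' (P' \<inter> Q' - P \<inter> Q)"
    using thin_partition[OF X P Q thin[unfolded TPQ]] .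
  have sub: "P \<subseteq> P'" "Q \<subseteq> Q'" "P' \<subseteq> X" "Q' \<subseteq> X"
    using PQ' by blast+
  have XPQ: "P' \<inter> Q' \<subseteq> {x. \<forall>i\<ge>N. x i = 0}"
    using sub(3) by (intro order_trans[OF _ X]) auto
  have clPQ: "closedin (top_of_set (P' \<inter> Q')) (P \<inter> Q)"
    by (rule closedin_subset_trans[OF closedin_Int[OF P Q]])
      (use sub in \<open>simp_all add: le_infI1 le_infI2\<close>)
  have contPQ: "continuous_on (P \<inter> Q) f"
    using f(1) TPQ by (auto intro: continuous_on_subset)
  have imPQ: "f ` (P \<inter> Q) \<subseteq> realization (K \<inter> L)"
    by (auto simp: P_def Q_def realization_Int[OF K(1) L(1)])
  obtain g0 where g0: "continuous_on (P' \<inter> Q') g0" "g0 ` (P' \<inter> Q') \<subseteq> realization (K \<inter> L)"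
      "\<And>x. x \<in> P \<inter> Q \<Longrightarrow> g0 x = f x"
    using extensorD[OF KL XPQ clPQ thin' contPQ imPQ] by blast
  have g0K: "g0 ` (P' \<inter> Q') \<subseteq> realization K" "g0 ` (P' \<inter> Q') \<subseteq> realization L"
    using g0(2) realization_Int[OF K(1) L(1)] by blast+
  have cl: "closedin (top_of_set P') P" "closedin (top_of_set P') (P' \<inter> Q')"
    "closedin (top_of_set Q') Q" "closedin (top_of_set Q') (P' \<inter> Q')"
    using closedin_subset_trans[OF P sub(1,3)] closedin_subset_trans[OF Q sub(2,4)]
      closedin_subset_trans[OF closedin_Int[OF P' Q'] _ sub(3)]
      closedin_subset_trans[OF closedin_Int[OF P' Q'] _ sub(4)] by simp_all
  have fPQ: "continuous_on P f" "continuous_on Q f" "f ` P \<subseteq> realization K" "f ` Q \<subseteq> realization L"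
    unfolding P_def Q_def by (auto intro!: continuous_on_subset[OF f(1)])
  \<comment> \<open>\<open>P\<close> meets \<open>Q'\<close> only inside \<open>Q\<close>, and on
    \<open>P \<inter> Q\<close> the map \<open>g0\<close> extends \<open>f\<close>.\<close>
  have agree: "f x = g0 x" if "x \<in> P" "x \<in> P' \<inter> Q'" for x
    using that PQ'(3) by (intro g0(3)[symmetric]) auto
  have agree': "f x = g0 x" if "x \<in> Q" "x \<in> P' \<inter> Q'" for x
    using that PQ'(2) by (intro g0(3)[symmetric]) auto
  obtain h1 where h1: "continuous_on P' h1" "h1 ` P' \<subseteq> realization K"
    "\<And>x. x \<in> P \<Longrightarrow> h1 x = f x" "\<And>x. x \<in> P' \<inter> Q' \<Longrightarrow> h1 x = g0 x"
    using cone_extension_glue[OF K cl(1,2) fPQ(1,3) g0(1) g0K(1) agree] by blast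
  obtain h2 where h2: "continuous_on Q' h2" "h2 ` Q' \<subseteq> realization L"
    "\<And>x. x \<in> Q \<Longrightarrow> h2 x = f x" "\<And>x. x \<in> P' \<inter> Q' \<Longrightarrow> h2 x = g0 x"
    using cone_extension_glue[OF L cl(3,4) fPQ(2,4) g0(1) g0K(2) agree'] by blast
  have h12: "h1 x = h2 x" if "x \<in> P'" "x \<in> Q'" for x
    using that h1(4) h2(4) by simp
  obtain g where g: "continuous_on (P' \<union> Q') g" "\<And>x. x \<in> P' \<Longrightarrow> g x = h1 x" "\<And>x. x \<in> Q' \<Longrightarrow> g x = h2 x"
    using continuous_on_glue[OF P'[folded PQ'(1)] Q'[folded PQ'(1)] h1(1) h2(1) h12] by blast
  have "g ` X \<subseteq> realization (K \<union> L)"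
    using g h1(2) h2(2) PQ'(1) by (fastforce simp: realization_Un)
  moreover have "g x = f x" if "x \<in> T" for x
    using that TPQ g h1(3) h2(3) sub by (metis UnE subsetD)
  ultimately show "\<exists>g. continuous_on X g \<and> g ` X \<subseteq> realization (K \<union> L) \<and> (\<forall>x\<in>T. g x = f x)"
    using g(1) PQ'(1) by blast
qed

text \<open>A map into \<open>K \<union> M\<close> is pushed off the interior of \<open>M\<close> by extending its restriction over the
  preimage of \<open>K \<inter> M\<close>.\<close>

lemma extensor_push_off:
  assumes K: "complex_on V K" and M: "complex_on V M"
    and KM: "extensor m (realization (K \<union> M))" "extensor m (realization (K \<inter> M))"
  shows "extensor m (realization K)"
  unfolding extensor_def
proof (intro allI impI)
  fix N S X T and f :: "(nat \<Rightarrow> real) \<Rightarrow> 'a \<Rightarrow> real"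
  assume X: "X \<subseteq> {x. \<forall>i\<ge>N. x i = 0}" and T: "closedin (top_of_set X) T"
    and thin: "thin m N S (X - T)" and f: "continuous_on T f" "f ` T \<subseteq> realization K"
  have "f ` T \<subseteq> realization (K \<union> M)"
    using f(2) by (auto simp: realization_Un)
  then obtain g where g: "continuous_on X g" "g ` X \<subseteq> realization (K \<union> M)" "\<And>x. x \<in> T \<Longrightarrow> g x = f x"
    using extensorD[OF KM(1) X T thin f(1)] by blast
  define P where "P = {x \<in> X. g x \<in> realization K}"
  define Q where "Q = {x \<in> X. g x \<in> realization M}"
  have PQ: "X = P \<union> Q"
    using g(2) by (auto simp: P_def Q_def realization_Un)
  have P: "closedin (top_of_set X) P" and Q: "closedin (top_of_set X) Q"
    unfolding P_def Q_def
    using closedin_preimage_realization[OF K g(1)] closedin_preimage_realization[OF M g(1)] .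
  have TP: "T \<subseteq> P"
    using f(2) g(3) closedin_imp_subset[OF T] by (auto simp: P_def)
  have XQ: "Q \<subseteq> {x. \<forall>i\<ge>N. x i = 0}"
    using PQ by (intro order_trans[OF _ X]) auto
  have clPQ: "closedin (top_of_set Q) (P \<inter> Q)"
    by (rule closedin_subset_trans[OF closedin_Int[OF P Q]]) (simp_all add: PQ)
  \<comment> \<open>\<open>T\<close> lies in \<open>P\<close>, so the part of \<open>Q\<close>
    outside \<open>P\<close> avoids \<open>T\<close> and inherits thinness.\<close>
  have thinQ: "thin m N S (Q - P \<inter> Q)"
    using TP PQ by (intro thin_subset[OF thin]) auto
  have contPQ: "continuous_on (P \<inter> Q) g"
    using g(1) PQ by (auto intro: continuous_on_subset)
  have imPQ: "g ` (P \<inter> Q) \<subseteq> realization (K \<inter> M)"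
    by (auto simp: P_def Q_def realization_Int[OF K M])
  obtain k where k: "continuous_on Q k" "k ` Q \<subseteq> realization (K \<inter> M)"
      "\<And>x. x \<in> P \<inter> Q \<Longrightarrow> k x = g x"
    using extensorD[OF KM(2) XQ clPQ thinQ contPQ imPQ] by blast
  have P': "closedin (top_of_set (P \<union> Q)) P" and Q': "closedin (top_of_set (P \<union> Q)) Q"
    unfolding PQ[symmetric] by (rule P, rule Q)
  have gP: "continuous_on P g"
    using g(1) PQ by (auto intro: continuous_on_subset)
  have gk: "g x = k x" if "x \<in> P" "x \<in> Q" for x
    using that by (intro k(3)[symmetric]) simp
  obtain h where h: "continuous_on (P \<union> Q) h" "\<And>x. x \<in> P \<Longrightarrow> h x = g x" "\<And>x. x \<in> Q \<Longrightarrow> h x = k x"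
    using continuous_on_glue[OF P' Q' gP k(1) gk] by blast
  have "h x \<in> realization K" if "x \<in> X" for x
  proof (cases "x \<in> P")
    case True
    then show ?thesis
      using h(2) by (simp add: P_def)
  next
    case False
    then have "x \<in> Q"
      using that PQ by blast
    then show ?thesis
      using h(3) k(2) by (auto simp: realization_Int[OF K M])
  qed
  then have "h ` X \<subseteq> realization K"
    by blast
  moreover have "h x = f x" if "x \<in> T" for x
    using that TP h(2) g(3) by (metis subsetD)
  ultimately show "\<exists>g. continuous_on X g \<and> g ` X \<subseteq> realization K \<and> (\<forall>x\<in>T. g x = f x)"
    using h(1) PQ by blast
qed

section \<open>Independence complexes\<close>

definition boundary_join :: "'a set \<Rightarrow> 'a set set \<Rightarrow> 'a set set" where
  "boundary_join e L = {S. \<not> e \<subseteq> S \<and> S - e \<in> L}"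

text \<open>\<open>P\<close> selects the subcomplex of the simplex: its instances are not containing
  a given set, omitting a vertex, and no restriction.\<close>

lemma complex_on_simplex_join:
  assumes "complex_on V L" "e \<subseteq> V" "\<And>S R. P S \<Longrightarrow> R \<subseteq> S \<Longrightarrow> P R"
  shows "complex_on V {S. P S \<and> S - e \<in> L}"
  unfolding complex_on_def
proof (intro conjI ballI allI impI)
  show "finite V"
    using complex_onD(1)[OF assms(1)] .
  show "{S. P S \<and> S - e \<in> L} \<subseteq> Pow V"
    using complex_onD(4)[OF assms(1)] assms(2) by blast
  show "R \<in> {S. P S \<and> S - e \<in> L}" if "S \<in> {S. P S \<and> S - e \<in> L}" "R \<subseteq> S" for S R
    using that assms(3)[of S R] complex_onD(5)[OF assms(1), of "S - e" "R - e"] by auto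
qed

text \<open>The boundary of the simplex on \<open>insert a e\<close> is the union of the cone with apex \<open>a\<close> over the
  boundary of \<open>e\<close> and of the simplex \<open>e\<close>, which meet in the boundary of \<open>e\<close>.\<close>

lemma extensor_boundary_join:
  assumes "finite e" "e \<noteq> {}" "e \<subseteq> V" "complex_on V L" "{} \<in> L" "\<And>S. S \<in> L \<Longrightarrow> S \<inter> e = {}"
    and "extensor m (realization L)"
  shows "extensor (m + card e - 1) (realization (boundary_join e L))"
  using assms
proof (induction e rule: finite_ne_induct)
  case (singleton b)
  have diff: "S - {b} = S" if "b \<notin> S" for S
    using that by blast
  have "boundary_join {b} L = L"
  proof (intro set_eqI iffI)
    show "S \<in> L" if "S \<in> boundary_join {b} L" for S
      using that by (auto simp: boundary_join_def diff)
    show "S \<in> boundary_join {b} L" if "S \<in> L" for S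
      using that singleton.prems(4)[OF that] by (auto simp: boundary_join_def diff)
  qed
  then show ?case
    using singleton.prems(5) by simp
next
  case (insert a e)
  define K where "K = {S. \<not> e \<subseteq> S \<and> S - insert a e \<in> L}"
  define M where "M = {S. a \<notin> S \<and> S - insert a e \<in> L}"
  have IH: "extensor (m + card e - 1) (realization (boundary_join e L))"
    using insert.prems by (intro insert.IH) auto
  have Un: "K \<union> M = boundary_join (insert a e) L"
    unfolding K_def M_def boundary_join_def by blast
  have "S - insert a e = S - e" if "a \<notin> S" for S
    using that by blast
  moreover have "a \<notin> S" if "S - e \<in> L" for S
    using insert.prems(4)[OF that] insert.hyps(3) by blast
  ultimately have Int: "K \<inter> M = boundary_join e L"
    unfolding K_def M_def boundary_join_def by (intro set_eqI) (metis (no_types, lifting) IntD1 IntD2 IntI mem_Collect_eq)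
  \<comment> \<open>Any vertex of \<open>e\<close> is an apex of \<open>M\<close>, which only
    excludes \<open>a\<close>.\<close>
  obtain b where b: "b \<in> e"
    using insert.hyps(2) by blast
  have "extensor (Suc (m + card e - 1)) (realization (K \<union> M))"
  proof (rule extensor_Un_cones)
    show "complex_on V K" "complex_on V M"
      unfolding K_def M_def using insert.prems(1,2) by (auto intro!: complex_on_simplex_join)
    show "a \<in> V" "b \<in> V"
      using b insert.prems(1) by auto
    show "{} \<in> K" "{} \<in> M"
      using insert.hyps(2) insert.prems(3) by (auto simp: K_def M_def)
    show "insert a S \<in> K" if "S \<in> K" for S
      using that insert.hyps(3) by (auto simp: K_def insert_Diff_if)
    show "insert b S \<in> M" if "S \<in> M" for S
      using that b insert.hyps(3) by (auto simp: M_def insert_Diff_if)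
    show "extensor (m + card e - 1) (realization (K \<inter> M))"
      unfolding Int by (rule IH)
  qed
  moreover have "card e > 0"
    using insert.hyps by (simp add: card_gt_0_iff)
  ultimately show ?case
    unfolding Un using insert.hyps by simp
qed

lemma complex_on_Ind: "finite V \<Longrightarrow> complex_on V (Ind V C)"
  unfolding complex_on_def Ind_def by auto

text \<open>Deletion and contraction of an edge \<open>e\<close>: the complexes of \<open>C\<close> and of \<open>C - {e}\<close> differ by the
  join of the open simplex \<open>e\<close> with \<open>Ind (V - e) {g - e | g. g \<in> C - {e}}\<close>. Allowing singletons in \<open>C\<close>
  and non-minimal edges makes the family closed under both operations.\<close>

lemma extensor_Ind:
  assumes "finite V" "C \<subseteq> Pow V" "{} \<notin> C"
    and "\<And>F. F \<subseteq> C \<Longrightarrow> card F < m \<Longrightarrow> \<exists>v\<in>V. {v} \<notin> C \<and> (\<forall>g\<in>C. v \<in> g \<longrightarrow> g \<inter> \<Union>F = {})"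
  shows "extensor m (realization (Ind V C))"
  using assms
proof (induction "card C" arbitrary: V C m rule: less_induct)
  case less
  have finC: "finite C"
    using less.prems(1,2) finite_subset by blast
  show ?case
  proof (cases m)
    case 0
    then show ?thesis
      by (simp add: extensor_0)
  next
    case (Suc n)
    show ?thesis
    proof (cases "\<exists>e\<in>C. \<forall>w. e \<noteq> {w}")
      case False
      \<comment> \<open>Here all edges are singletons. As \<open>m\<close> is positive, the empty
        family yields a \<open>v\<close> that is not an edge; it lies in no edge and is a cone
        apex.\<close>
      obtain v where v: "v \<in> V" "{v} \<notin> C"
        using less.prems(4)[of "{}"] Suc by auto
      show ?thesis
      proof (rule extensor_cone)
        show "complex_on V (Ind V C)"
          using less.prems(1) by (rule complex_on_Ind)
        show "{} \<in> Ind V C"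
          using less.prems(3) by (auto simp: Ind_def)
        show "insert v S \<in> Ind V C" if S: "S \<in> Ind V C" for S
        proof -
          have "\<not> g \<subseteq> insert v S" if g: "g \<in> C" for g
          proof -
            obtain w where "g = {w}"
              using False g by blast
            then show ?thesis
              using v S g by (auto simp: Ind_def)
          qed
          then show ?thesis
            using S v(1) by (auto simp: Ind_def)
        qed
      qed (rule v(1))
    next
      case True
      then obtain e where e: "e \<in> C" "\<And>w. e \<noteq> {w}"
        by blast
      have "e \<noteq> {}" "e \<subseteq> V"
        using e less.prems(2,3) by auto
      then have "finite e"
        using less.prems(1) finite_subset by blast
      \<comment> \<open>Deletion keeps \<open>m\<close>: a vertex undominated in \<open>C\<close>
        stays so with fewer edges.\<close>
      have C1: "extensor m (realization (Ind V (C - {e})))"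
      proof (rule less.hyps)
        show "card (C - {e}) < card C"
          using finC e(1) by (rule card_Diff1_less)
        show "\<exists>v\<in>V. {v} \<notin> C - {e} \<and> (\<forall>g\<in>C - {e}. v \<in> g \<longrightarrow> g \<inter> \<Union>F = {})"
          if F: "F \<subseteq> C - {e}" "card F < m" for F
        proof -
          have "F \<subseteq> C"
            using F(1) by auto
          then obtain v where "v \<in> V" "{v} \<notin> C" "\<forall>g\<in>C. v \<in> g \<longrightarrow> g \<inter> \<Union>F = {}"
            using less.prems(4) F(2) by meson
          then show ?thesis
            by (intro bexI[of _ v]) auto
        qed
      qed (use less.prems in auto)
      show ?thesis
      proof (cases "\<exists>g\<in>C. g \<subset> e")
        case True
        then have "Ind V C = Ind V (C - {e})"
          unfolding Ind_def by blast
        then show ?thesis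
          using C1 by simp
      next
        case False
        define C2 where "C2 = (\<lambda>g. g - e) ` (C - {e})"
        define L where "L = Ind (V - e) C2"
        define M where "M = {S. True \<and> S - e \<in> L}"
        have "{} \<notin> C2"
          using False by (auto simp: C2_def)
        have "card C2 \<le> card (C - {e})"
          unfolding C2_def using finC by (intro card_image_le) simp
        also have "\<dots> < card C"
          using finC e(1) by (rule card_Diff1_less)
        finally have cardC2: "card C2 < card C" .
        have "extensor n (realization L)"
          unfolding L_def
        proof (rule less.hyps[OF cardC2])
          show "finite (V - e)" "C2 \<subseteq> Pow (V - e)" "{} \<notin> C2"
            using less.prems(1,2) \<open>{} \<notin> C2\<close> by (auto simp: C2_def)
          fix F assume "F \<subseteq> C2" and cardF: "card F < n"
          \<comment> \<open>One lift per edge keeps the cardinality, so adding \<open>e\<close>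
            gives a family of fewer than \<open>n + 1 = m\<close> edges of \<open>C\<close>.\<close>
          then obtain F0 where F0: "F0 \<subseteq> C - {e}" "inj_on (\<lambda>g. g - e) F0" "F = (\<lambda>g. g - e) ` F0"
            unfolding C2_def by (auto simp: subset_image_inj)
          have sub: "insert e F0 \<subseteq> C"
            using F0(1) e(1) by auto
          have "card (insert e F0) < m"
            using cardF Suc card_insert_le_m1[of "Suc (card F0)" F0 e] F0(2,3) by (simp add: card_image)
          then obtain v where v: "v \<in> V" "{v} \<notin> C" "\<And>g. g \<in> C \<Longrightarrow> v \<in> g \<Longrightarrow> g \<inter> \<Union>(insert e F0) = {}"
            using less.prems(4)[OF sub] by meson
          have "v \<notin> e"
            using v(3)[OF e(1)] by auto
          \<comment> \<open>An edge shrinking to \<open>{v}\<close> contains \<open>v\<close>, hence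
            misses \<open>e\<close> by the choice of \<open>v\<close>, and would already be
            \<open>{v}\<close> in \<open>C\<close>.\<close>
          moreover have "{v} \<notin> C2"
          proof
            assume "{v} \<in> C2"
            then obtain g where g: "g \<in> C" "{v} = g - e"
              by (auto simp: C2_def)
            then have "g \<inter> e = {}"
              using v(3)[of g] by blast
            then have "g = {v}"
              using g(2) by blast
            then show False
              using g(1) v(2) by simp
          qed
          moreover have "g \<inter> \<Union>F = {}" if "g \<in> C2" "v \<in> g" for g
          proof -
            obtain g' where g': "g' \<in> C" "g = g' - e"
              using \<open>g \<in> C2\<close> by (auto simp: C2_def)
            then have "g' \<inter> \<Union>(insert e F0) = {}"
              using v(3)[of g'] \<open>v \<in> g\<close> by blast
            then show ?thesis
              unfolding g'(2) F0(3) by blast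
          qed
          ultimately show "\<exists>v\<in>V - e. {v} \<notin> C2 \<and> (\<forall>g\<in>C2. v \<in> g \<longrightarrow> g \<inter> \<Union>F = {})"
            using v(1) by blast
        qed
        have L: "complex_on V L"
          unfolding L_def using complex_on_Ind[of "V - e" C2] less.prems(1) by (auto simp: complex_on_def)
        have "extensor (n + card e - 1) (realization (boundary_join e L))"
        proof (rule extensor_boundary_join)
          show "{} \<in> L"
            using \<open>{} \<notin> C2\<close> by (auto simp: L_def Ind_def)
          show "S \<inter> e = {}" if "S \<in> L" for S
            using that by (auto simp: L_def Ind_def)
        qed fact+
        \<comment> \<open>As \<open>e\<close> has at least two vertices, the join with its boundary
          regains the one lost by contraction.\<close>
        moreover have "card e \<noteq> 0" "card e \<noteq> 1"
          using \<open>finite e\<close> \<open>e \<noteq> {}\<close> e(2) by (auto simp: card_1_singleton_iff)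
        then have "m \<le> n + card e - 1"
          using Suc by simp
        ultimately have J: "extensor m (realization (boundary_join e L))"
          by (rule extensor_mono)
        \<comment> \<open>In this form, a set that contains \<open>e\<close> and no other edge is
          seen to lie in \<open>M\<close>, as needed for the union.\<close>
        have L_iff: "S - e \<in> L \<longleftrightarrow> S \<subseteq> V \<and> (\<forall>g\<in>C - {e}. \<not> g \<subseteq> S \<union> e)" for S
        proof -
          have "g - e \<subseteq> S - e \<longleftrightarrow> g \<subseteq> S \<union> e" for g
            by blast
          moreover have "S - e \<subseteq> V - e \<longleftrightarrow> S \<subseteq> V"
            using \<open>e \<subseteq> V\<close> by blast
          ultimately show ?thesis
            by (simp add: L_def Ind_def C2_def)
        qed
        have Un: "Ind V C \<union> M = Ind V (C - {e})"
        proof (intro set_eqI iffI)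
          show "S \<in> Ind V (C - {e})" if "S \<in> Ind V C \<union> M" for S
            using that L_iff[of S] by (auto simp: Ind_def M_def)
          show "S \<in> Ind V C \<union> M" if S: "S \<in> Ind V (C - {e})" for S
          proof (cases "e \<subseteq> S")
            case True
            then have "S \<union> e = S"
              by blast
            then show ?thesis
              using S L_iff[of S] by (simp add: Ind_def M_def)
          next
            case False
            then show ?thesis
              using S by (auto simp: Ind_def)
          qed
        qed
        have Int: "Ind V C \<inter> M = boundary_join e L"
        proof (intro set_eqI iffI)
          show "S \<in> boundary_join e L" if "S \<in> Ind V C \<inter> M" for S
            using that e(1) by (auto simp: Ind_def M_def boundary_join_def)
          show "S \<in> Ind V C \<inter> M" if "S \<in> boundary_join e L" for S
            using that L_iff[of S] by (auto simp: Ind_def M_def boundary_join_def)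
        qed
        show ?thesis
        proof (rule extensor_push_off)
          show "complex_on V (Ind V C)"
            using less.prems(1) by (rule complex_on_Ind)
          show "complex_on V M"
            unfolding M_def using L \<open>e \<subseteq> V\<close> by (rule complex_on_simplex_join) simp
        qed (use C1 J in \<open>simp_all add: Un Int\<close>)
      qed
    qed
  qed
qed

section \<open>From domination numbers to the bound\<close>

lemma eps_le:
  assumes "finite C" "edgewise_dominant V C F"
  shows "eps V C \<le> card F"
proof -
  have "{card F | F. edgewise_dominant V C F} \<subseteq> card ` Pow C"
    by (auto simp: edgewise_dominant_def)
  then have "finite {card F | F. edgewise_dominant V C F}"
    using assms(1) by (meson finite_Pow_iff finite_imageI finite_subset)
  then show ?thesis
    unfolding eps_def using assms(2) by (intro Min_le) auto
qed

theorem theorem3p11: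
  fixes V :: "'a set" and C :: "'a set set"
  assumes "hypergraph V C"
  shows "conn_ge (Ind V C) (int (eps V C) - 2)"
proof -
  have V: "finite V" and C: "C \<subseteq> Pow V" and card2: "\<And>e. e \<in> C \<Longrightarrow> 2 \<le> card e"
    using assms by (auto simp: hypergraph_def)
  have "finite C"
    using V C finite_subset by blast
  have "extensor (eps V C) (realization (Ind V C))"
  proof (rule extensor_Ind[OF V C])
    show "{} \<notin> C"
      using card2 by force
    fix F assume F: "F \<subseteq> C" "card F < eps V C"
    then have "\<not> edgewise_dominant V C F"
      using eps_le[OF \<open>finite C\<close>] by (meson leD)
    then obtain v where v: "v \<in> V" "\<forall>e\<in>F. v \<notin> e"
      "\<not> (\<exists>u. neighbours C v u \<and> (\<exists>e\<in>F. u \<in> e))"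
      using F(1) by (auto simp: edgewise_dominant_def)
    have "g \<inter> \<Union>F = {}" if g: "g \<in> C" "v \<in> g" for g
    proof (rule ccontr)
      assume "g \<inter> \<Union>F \<noteq> {}"
      then obtain u f where u: "u \<in> g" "u \<in> f" "f \<in> F"
        by blast
      \<comment> \<open>\<open>u\<close> differs from \<open>v\<close>, since \<open>u\<close> lies
        in an edge of \<open>F\<close> and \<open>v\<close> in none.\<close>
      then have "neighbours C v u"
        unfolding neighbours_def using v(2) g by blast
      then show False
        using v(3) u by blast
    qed
    moreover have "{v} \<notin> C"
      using card2[of "{v}"] by auto
    ultimately show "\<exists>v\<in>V. {v} \<notin> C \<and> (\<forall>g\<in>C. v \<in> g \<longrightarrow> g \<inter> \<Union>F = {})"
      using v(1) by blast
  qed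
  then show ?thesis
    by (rule extensor_imp_conn_ge) simp
qed

end
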